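(* Let $n\ge2$ and $d$ be integers with $n/2\le d<n$, put $m=n-d$, and let $A>0$. Let $\phi:[0,1]^d\to\mathbb R^m$ be a $C^2$ function with $\|\phi\|_{C^2}\le A$. For every $\epsilon>0$ there exist $Q_0\ge1$ and $c_0>0$, depending only on $\epsilon,n,d,A$, such that for every integer $Q\ge Q_0$ there exist a $C^2$ function $\psi:[0,1]^d\to\mathbb R^m$ with $\|\phi-\psi\|_{C^2}\le\epsilon$ and a not identically zero sequence $(b_{\mathbf q})_{\mathbf q\in[Q]^d}\subset\mathbb C$ for which, for all $1\le p<\infty$, $$\left\|\sup_{\mathbf t\in[0,Q^2]^m}\left|\sum_{\mathbf q\in[Q]^d}b_{\mathbf q}\,e\bigl(\mathbf x\cdot\mathbf q/Q+\mathbf t\cdot\psi(\mathbf q/Q)\bigr)\right|\right\|_{L^p_{\mathbf x}([0,Q]^d)}\ \ge\ c_0\,Q^{\frac{dn}{2(d+2m)}+\frac mp}\,\|b\|_{\ell^2}.$$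
   Context: Notation: $e(z)=e^{2\pi i z}$; $[Q]=\{1,\dots,Q\}$; $\|b\|_{\ell^2}=\bigl(\sum_{\mathbf q\in[Q]^d}|b_{\mathbf q}|^2\bigr)^{1/2}$. The $C^2$ norm is $\|\phi\|_{C^2}=\max_{0\le|\alpha|\le2}\sup_{\xi\in[0,1]^d}|D^\alpha\phi(\xi)|$. *)

theory Defs
  imports "HOL-Analysis.Analysis"
begin

definition cube :: "real \<Rightarrow> (real ^ 'k) set" where
  "cube r = cbox 0 (vec r)"

(* The derivative is taken along the slice of S through x, so it is one-sided at those
   boundary points of a cube where only one side is available. *)
definition partial_within ::
    "(real ^ 'd) set \<Rightarrow> 'd \<Rightarrow> (real ^ 'd \<Rightarrow> 'b::real_normed_vector) \<Rightarrow> real ^ 'd \<Rightarrow> 'b" where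
  "partial_within S i f x =
     vector_derivative (\<lambda>s. f (x + s *\<^sub>R axis i 1)) (at 0 within {s. x + s *\<^sub>R axis i 1 \<in> S})"

definition has_partial_within ::
    "(real ^ 'd) set \<Rightarrow> 'd \<Rightarrow> (real ^ 'd \<Rightarrow> 'b::real_normed_vector) \<Rightarrow> real ^ 'd \<Rightarrow> bool" where
  "has_partial_within S i f x \<longleftrightarrow>
     (\<lambda>s. f (x + s *\<^sub>R axis i 1)) differentiable (at 0 within {s. x + s *\<^sub>R axis i 1 \<in> S})"

(* D^alpha f.  A multi-index alpha is given by a list of the coordinates to differentiate in,
   so that |alpha| is the length of the list.  For a C^2 function and |alpha| <= 2 the
   order of the list is irrelevant. *)
fun iter_partial ::
    "(real ^ 'd) set \<Rightarrow> 'd list \<Rightarrow> (real ^ 'd \<Rightarrow> 'b::real_normed_vector) \<Rightarrow> real ^ 'd \<Rightarrow> 'b" where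
  "iter_partial S [] f = f"
| "iter_partial S (i # \<alpha>) f = partial_within S i (iter_partial S \<alpha> f)"

definition C_k_on :: "nat \<Rightarrow> (real ^ 'd) set \<Rightarrow> (real ^ 'd \<Rightarrow> 'b::real_normed_vector) \<Rightarrow> bool" where
  "C_k_on k S f \<longleftrightarrow>
     (\<forall>\<alpha> i. length \<alpha> < k \<longrightarrow> (\<forall>x\<in>S. has_partial_within S i (iter_partial S \<alpha> f) x)) \<and>
     (\<forall>\<alpha>. length \<alpha> \<le> k \<longrightarrow> continuous_on S (iter_partial S \<alpha> f))"

definition C2_norm :: "(real ^ 'd \<Rightarrow> 'b::real_normed_vector) \<Rightarrow> real" where
  "C2_norm f =
     Max ((\<lambda>\<alpha>. SUP \<xi>\<in>cube 1. norm (iter_partial (cube 1) \<alpha> f \<xi>)) ` {\<alpha>. length \<alpha> \<le> 2})"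

definition e :: "real \<Rightarrow> complex" where
  "e z = exp (2 * of_real pi * \<i> * of_real z)"

definition grid :: "nat \<Rightarrow> (nat ^ 'd) set" where
  "grid Q = {q. \<forall>i. q $ i \<in> {1..Q}}"

definition scaled :: "nat \<Rightarrow> nat ^ 'd \<Rightarrow> real ^ 'd" where
  "scaled Q q = (\<chi> i. real (q $ i) / real Q)"

definition l2_norm :: "nat \<Rightarrow> (nat ^ 'd \<Rightarrow> complex) \<Rightarrow> real" where
  "l2_norm Q b = sqrt (\<Sum>q\<in>grid Q. (cmod (b q))\<^sup>2)"

definition exp_sum ::
    "nat \<Rightarrow> (nat ^ 'd \<Rightarrow> complex) \<Rightarrow> (real ^ 'd \<Rightarrow> real ^ 'm) \<Rightarrow> real ^ 'd \<Rightarrow> real ^ 'm \<Rightarrow> complex" where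
  "exp_sum Q b \<psi> x t = (\<Sum>q\<in>grid Q. b q * e (x \<bullet> scaled Q q + t \<bullet> \<psi> (scaled Q q)))"

definition maximal_fn ::
    "nat \<Rightarrow> (nat ^ 'd \<Rightarrow> complex) \<Rightarrow> (real ^ 'd \<Rightarrow> real ^ 'm) \<Rightarrow> real ^ 'd \<Rightarrow> real" where
  "maximal_fn Q b \<psi> x = (SUP t\<in>cube (real Q ^ 2). cmod (exp_sum Q b \<psi> x t))"

definition Lp_norm_on :: "real \<Rightarrow> (real ^ 'd) set \<Rightarrow> (real ^ 'd \<Rightarrow> real) \<Rightarrow> real" where
  "Lp_norm_on p S f = (LINT x:S|lborel. \<bar>f x\<bar> powr p) powr (1 / p)"

end

theory Submission
  imports Defs
begin

text \<open>
  Put \<open>s = d + 2 * m\<close> and let \<open>R\<close> be the integer part of \<open>Q powr (m / s)\<close> and \<open>\<kappa> = Q / R\<close>. The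
  sequence \<open>b\<close> is the indicator of the grid points with all coordinates divisible by \<open>R\<close>; there
  are \<open>N \<approx> \<kappa>\<^sup>d\<close> of them, so \<open>b\<close> has norm \<open>sqrt N\<close>. The points \<open>\<xi> = q / Q\<close>
  form a piece of the lattice \<open>(1 / \<kappa>) * \<int>\<^sup>d\<close>, hence at \<open>t = 0\<close> all terms of the sum
  are in phase when \<open>x\<close> is near \<open>\<kappa> * \<int>\<^sup>d\<close>.

  The function \<open>\<psi>\<close> creates many further resonances. Bumps of height \<open>\<eta> / \<kappa>\<^sup>2\<close> at the points
  \<open>\<xi>\<close>, which are \<open>1 / \<kappa>\<close>-separated, change the \<open>C\<^sup>2\<close> norm by only a constant multiple of
  \<open>\<eta>\<close> (\<open>C2_interpolation\<close>). They suffice to move \<open>\<phi>\<close> at every \<open>\<xi>\<close> so that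
  \<open>(\<kappa>\<^sup>2 / \<eta>) * \<psi> \<xi> + \<xi>'\<close> is an integer vector (\<open>rounded_function\<close>), where \<open>\<xi>'\<close>
  consists of \<open>m\<close> of the \<open>d\<close> coordinates of \<open>\<xi>\<close>. For integer vectors \<open>\<tau>\<close> and
  \<open>t = (\<kappa>\<^sup>2 / \<eta>) * \<tau>\<close>, the phase \<open>t \<bullet> \<psi> \<xi>\<close> is then \<open>- \<tau> \<bullet> \<xi>'\<close> modulo 1, so that the sum is in phase
  near \<open>\<kappa> * \<int>\<^sup>d + \<tau>\<close> and has absolute value at least \<open>N / 2\<close> there
  (\<open>maximal_fn_resonance\<close>).

  The constraint \<open>t \<in> [0, Q\<^sup>2]\<^sup>m\<close> allows about \<open>\<eta> * R\<^sup>2\<close> values for each entry of \<open>\<tau>\<close>. As \<open>m \<le> d\<close>,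
  this number is smaller than the period \<open>\<kappa>\<close>, and the resonant boxes in \<open>[0, Q]\<^sup>d\<close> are disjoint. Their
  union has measure comparable to \<open>R\<^sup>d * (R\<^sup>2)\<^sup>m \<approx> Q\<^sup>m\<close> (\<open>resonant_set\<close>). Therefore the
  \<open>L\<^sup>p\<close> norm is at least a constant times \<open>N * Q powr (m / p)\<close>, which is
  \<open>sqrt N * Q powr (m / p)\<close> times the norm of \<open>b\<close>, and \<open>sqrt N\<close> is comparable to
  \<open>Q powr (d * n / (2 * s))\<close>.
\<close>

section \<open>Iterated partial derivatives on the cube\<close>

lemma mem_cube_iff: "x \<in> cube r \<longleftrightarrow> (\<forall>i. 0 \<le> x $ i \<and> x $ i \<le> r)"
  by (auto simp: cube_def mem_box_cart)

lemma slice_cube: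
  fixes x :: "real ^ 'd"
  assumes "x \<in> cube 1"
  shows "{s. x + s *\<^sub>R axis i 1 \<in> cube 1} = cbox (- x $ i) (1 - x $ i)"
proof (intro set_eqI iffI)
  fix s assume "s \<in> {s. x + s *\<^sub>R axis i 1 \<in> cube 1}"
  then have "0 \<le> (x + s *\<^sub>R axis i 1) $ i \<and> (x + s *\<^sub>R axis i 1) $ i \<le> 1"
    unfolding mem_Collect_eq mem_cube_iff by blast
  then show "s \<in> cbox (- x $ i) (1 - x $ i)"
    by simp
next
  fix s assume s: "s \<in> cbox (- x $ i) (1 - x $ i)"
  have "0 \<le> (x + s *\<^sub>R axis i 1) $ j \<and> (x + s *\<^sub>R axis i 1) $ j \<le> 1" for j
    using s assms by (cases "j = i") (auto simp: mem_cube_iff axis_def)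
  then show "s \<in> {s. x + s *\<^sub>R axis i 1 \<in> cube 1}"
    by (simp add: mem_cube_iff)
qed

lemma partial_within_cube_eqI:
  fixes f g :: "real ^ 'd \<Rightarrow> 'b::real_normed_vector"
  assumes x: "x \<in> cube 1"
    and der: "((\<lambda>s. f (x + s *\<^sub>R axis i 1)) has_vector_derivative f')
                (at 0 within {s. x + s *\<^sub>R axis i 1 \<in> cube 1})"
    and eq: "\<And>y. y \<in> cube 1 \<Longrightarrow> g y = f y"
  shows "partial_within (cube 1) i g x = f'" and "has_partial_within (cube 1) i g x"
proof -
  let ?S = "{s. x + s *\<^sub>R axis i 1 \<in> cube 1}"
  have "((\<lambda>s. g (x + s *\<^sub>R axis i 1)) has_vector_derivative f') (at 0 within ?S)"
    by (rule has_vector_derivative_transform[OF _ _ der]) (use x eq in auto)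
  moreover have "?S = cbox (- x $ i) (1 - x $ i)"
    by (rule slice_cube[OF x])
  moreover have "0 \<in> cbox (- x $ i) (1 - x $ i)"
    using x by (simp add: mem_cube_iff)
  ultimately show "partial_within (cube 1) i g x = f'" "has_partial_within (cube 1) i g x"
    unfolding partial_within_def has_partial_within_def
    using vector_derivative_within_cbox[of "- x $ i" "1 - x $ i" 0 "\<lambda>s. g (x + s *\<^sub>R axis i 1)" f']
    by (auto intro: differentiableI_vector)
qed

text \<open>A family \<open>D\<close> indexed by multi-indices whose members are the successive partial derivatives
  of \<open>D []\<close> along the edges of the cube is the family of iterated partials.\<close>

lemma iter_partial_family:
  fixes D :: "'d::finite list \<Rightarrow> real ^ 'd \<Rightarrow> 'b::real_normed_vector"
  assumes der: "\<And>\<alpha> i x. length \<alpha> < k \<Longrightarrow> x \<in> cube 1 \<Longrightarrow>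
      ((\<lambda>s. D \<alpha> (x + s *\<^sub>R axis i 1)) has_vector_derivative D (i # \<alpha>) x)
        (at 0 within {s. x + s *\<^sub>R axis i 1 \<in> cube 1})"
  shows "length \<alpha> \<le> k \<Longrightarrow> x \<in> cube 1 \<Longrightarrow> iter_partial (cube 1) \<alpha> (D []) x = D \<alpha> x"
proof (induction \<alpha> arbitrary: x)
  case (Cons i \<alpha>)
  have "partial_within (cube 1) i (iter_partial (cube 1) \<alpha> (D [])) x = D (i # \<alpha>) x"
    by (rule partial_within_cube_eqI(1)[where f = "D \<alpha>"]) (use Cons der in auto)
  then show ?case by simp
qed simp

lemma C_k_on_family:
  fixes D :: "'d::finite list \<Rightarrow> real ^ 'd \<Rightarrow> 'b::real_normed_vector"
  assumes der: "\<And>\<alpha> i x. length \<alpha> < k \<Longrightarrow> x \<in> cube 1 \<Longrightarrow>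
      ((\<lambda>s. D \<alpha> (x + s *\<^sub>R axis i 1)) has_vector_derivative D (i # \<alpha>) x)
        (at 0 within {s. x + s *\<^sub>R axis i 1 \<in> cube 1})"
    and cont: "\<And>\<alpha>. length \<alpha> \<le> k \<Longrightarrow> continuous_on (cube 1) (D \<alpha>)"
  shows "C_k_on k (cube 1) (D [])"
  unfolding C_k_on_def
proof (intro conjI allI impI ballI)
  fix \<alpha> :: "'d list" and i and x :: "real ^ 'd"
  assume "length \<alpha> < k" "x \<in> cube 1"
  then show "has_partial_within (cube 1) i (iter_partial (cube 1) \<alpha> (D [])) x"
    using iter_partial_family[of k D \<alpha>, OF der]
    by (intro partial_within_cube_eqI(2)[OF _ der[of \<alpha>]]) auto
next
  fix \<alpha> :: "'d list" assume "length \<alpha> \<le> k"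
  then show "continuous_on (cube 1) (iter_partial (cube 1) \<alpha> (D []))"
    using cont[of \<alpha>] iter_partial_family[of k D \<alpha>, OF der] by (simp cong: continuous_on_cong)
qed

lemma C_k_on_cube_partial:
  fixes f :: "real ^ 'd \<Rightarrow> 'b::real_normed_vector"
  assumes "C_k_on k (cube 1) f" "length \<alpha> < k" "x \<in> cube 1"
  shows "((\<lambda>s. iter_partial (cube 1) \<alpha> f (x + s *\<^sub>R axis i 1)) has_vector_derivative
           iter_partial (cube 1) (i # \<alpha>) f x) (at 0 within {s. x + s *\<^sub>R axis i 1 \<in> cube 1})"
  using assms
  by (auto simp: C_k_on_def has_partial_within_def partial_within_def vector_derivative_works)

lemma C2_norm_leI:
  fixes f :: "real ^ 'd::finite \<Rightarrow> 'b::real_normed_vector"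
  assumes "\<And>\<alpha> x. length \<alpha> \<le> 2 \<Longrightarrow> x \<in> cube 1 \<Longrightarrow> norm (iter_partial (cube 1) \<alpha> f x) \<le> B"
  shows "C2_norm f \<le> B"
proof -
  have fin: "finite {\<alpha> :: 'd list. length \<alpha> \<le> 2}"
    using finite_lists_length_le[of "UNIV :: 'd set" 2] by simp
  have ne: "cube 1 \<noteq> ({} :: (real ^ 'd) set)"
    by (metis empty_iff mem_cube_iff order_refl zero_index zero_le_one)
  show ?thesis
    unfolding C2_norm_def
    by (rule Max.boundedI) (use fin ne assms in \<open>auto intro!: cSUP_least exI[of _ "[]"]\<close>)
qed

section \<open>Interpolation by small bumps\<close>

lemma DERIV_max_0_power:
  "((\<lambda>y::real. max 0 y ^ (n + 2)) has_real_derivative real (n + 2) * max 0 y ^ (n + 1)) (at y)"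
proof -
  have *: "((\<lambda>y::real. if y \<in> {0..} then y ^ (n + 2) else 0) has_vector_derivative
     (if y \<in> {0..} then real (n + 2) * y ^ (n + 1) else 0)) (at y within UNIV)"
  proof (rule has_vector_derivative_If_within_closures[where T = "{..0}"])
    show "((\<lambda>y::real. y ^ (n + 2)) has_vector_derivative real (n + 2) * y ^ (n + 1))
        (at y within {0..} \<union> closure {0..} \<inter> closure {..0})"
      unfolding has_real_derivative_iff_has_vector_derivative[symmetric]
      by (rule derivative_eq_intros refl | simp)+
  qed auto
  have "(\<lambda>y::real. if y \<in> {0..} then y ^ (n + 2) else 0) = (\<lambda>y. max 0 y ^ (n + 2))"
    by (auto simp: max_def fun_eq_iff)
  moreover have "(if y \<in> {0..} then real (n + 2) * y ^ (n + 1) else 0) = real (n + 2) * max 0 y ^ (n + 1)"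
    by (auto simp: max_def)
  ultimately show ?thesis
    using * by (simp only: has_real_derivative_iff_has_vector_derivative)
qed

text \<open>The profile of the bump with centre \<open>p\<close> and radius \<open>1 / (2 * \<kappa>)\<close>. The bump is its third
  power, which is just regular enough to be of class \<open>C\<^sup>2\<close>.\<close>

definition bump_profile :: "real \<Rightarrow> real ^ 'd \<Rightarrow> real ^ 'd \<Rightarrow> real" where
  "bump_profile \<kappa> p x = max 0 (1 - 4 * \<kappa>\<^sup>2 * ((x - p) \<bullet> (x - p)))"

text \<open>The partial derivatives of order at most two of the bump; the last entry of the list is the
  coordinate in which it is differentiated first. Longer multi-indices get the value 0 and are never
  used.\<close>

fun bump_partial :: "real \<Rightarrow> real ^ 'd \<Rightarrow> 'd list \<Rightarrow> real ^ 'd \<Rightarrow> real" where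
  "bump_partial \<kappa> p [] x = bump_profile \<kappa> p x ^ 3"
| "bump_partial \<kappa> p [i] x = - 24 * \<kappa>\<^sup>2 * bump_profile \<kappa> p x ^ 2 * (x - p) $ i"
| "bump_partial \<kappa> p [j, i] x =
     384 * \<kappa> ^ 4 * bump_profile \<kappa> p x * (x - p) $ i * (x - p) $ j
       - 24 * \<kappa>\<^sup>2 * bump_profile \<kappa> p x ^ 2 * (if i = j then 1 else 0)"
| "bump_partial \<kappa> p _ x = 0"

lemma bump_profile_power_deriv:
  "((\<lambda>s. bump_profile \<kappa> p (x + s *\<^sub>R axis j 1) ^ (n + 2)) has_real_derivative
      - 8 * real (n + 2) * \<kappa>\<^sup>2 * bump_profile \<kappa> p x ^ (n + 1) * (x - p) $ j) (at 0)"
proof -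
  define y where "y = x - p"
  have eq: "(x + s *\<^sub>R axis j 1 - p) \<bullet> (x + s *\<^sub>R axis j 1 - p) = y \<bullet> y + 2 * s * y $ j + s\<^sup>2" for s
  proof -
    have "x + s *\<^sub>R axis j 1 - p = y + s *\<^sub>R axis j 1" by (simp add: y_def)
    moreover have "(y + s *\<^sub>R axis j 1) \<bullet> (y + s *\<^sub>R axis j 1) = y \<bullet> y + 2 * s * y $ j + s\<^sup>2"
      by (simp add: inner_add_left inner_add_right inner_axis inner_axis' inner_axis_axis power2_eq_square distrib_left)
    ultimately show ?thesis by (simp only:)
  qed
  have q: "((\<lambda>s. 1 - 4 * \<kappa>\<^sup>2 * (y \<bullet> y + 2 * s * y $ j + s\<^sup>2)) has_real_derivative
      - 8 * \<kappa>\<^sup>2 * y $ j) (at 0)"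
    by (auto intro!: derivative_eq_intros)
  show ?thesis
    unfolding bump_profile_def eq y_def[symmetric]
    by (rule DERIV_chain2[OF DERIV_max_0_power q, THEN DERIV_cong]) (simp add: algebra_simps)
qed

lemma bump_partial_deriv:
  assumes "length \<alpha> < 2"
  shows "((\<lambda>s. bump_partial \<kappa> p \<alpha> (x + s *\<^sub>R axis j 1)) has_real_derivative
            bump_partial \<kappa> p (j # \<alpha>) x) (at 0)"
proof (cases \<alpha>)
  case Nil
  then show ?thesis
    using bump_profile_power_deriv[where n = 1]
    by (simp add: power3_eq_cube numeral_3_eq_3 power2_eq_square)
next
  case (Cons i \<beta>)
  then have \<alpha>: "\<alpha> = [i]" using assms by simp
  have l: "((\<lambda>s. (x + s *\<^sub>R axis j 1 - p) $ i) has_real_derivative (if i = j then 1 else 0)) (at 0)"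
    by (auto simp: axis_def intro!: derivative_eq_intros)
  have h: "((\<lambda>s. bump_profile \<kappa> p (x + s *\<^sub>R axis j 1) ^ 2) has_real_derivative
      - 16 * \<kappa>\<^sup>2 * bump_profile \<kappa> p x * (x - p) $ j) (at 0)"
    using bump_profile_power_deriv[of \<kappa> p x j 0] by (simp add: power2_eq_square)
  show ?thesis
    unfolding \<alpha> bump_partial.simps mult.assoc[of "- 24 * \<kappa>\<^sup>2"]
    by (rule DERIV_cmult[OF DERIV_mult[OF h l], THEN DERIV_cong])
      (simp add: algebra_simps power2_eq_square power4_eq_xxxx)
qed

lemma continuous_on_bump_partial: "continuous_on S (bump_partial \<kappa> p \<alpha>)"
  by (cases "(\<kappa>, p, \<alpha>, 0 :: real ^ 'a)" rule: bump_partial.cases)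
    (auto simp: bump_profile_def intro!: continuous_intros)

lemma bump_partial_support:
  assumes "\<kappa> > 0" "dist x p \<ge> 1 / (2 * \<kappa>)"
  shows "bump_partial \<kappa> p \<alpha> x = 0"
proof -
  have "(1 / (2 * \<kappa>))\<^sup>2 \<le> (norm (x - p))\<^sup>2"
    using assms by (intro power_mono) (auto simp: dist_norm)
  then have "1 - 4 * \<kappa>\<^sup>2 * ((x - p) \<bullet> (x - p)) \<le> 0"
    using assms(1) by (simp add: power2_norm_eq_inner field_simps)
  then have "bump_profile \<kappa> p x = 0"
    by (simp add: bump_profile_def)
  then show ?thesis
    by (cases "(\<kappa>, p, \<alpha>, x)" rule: bump_partial.cases) auto
qed

text \<open>The constant comes from the second derivatives: on the support, \<open>2 * \<kappa> * (x - p) $ i\<close> has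
  absolute value at most 1, so that they are at most \<open>(96 + 24) * \<kappa>\<^sup>2\<close>.\<close>

lemma bump_partial_bound:
  assumes "\<kappa> \<ge> 1" "length \<alpha> \<le> 2"
  shows "\<bar>bump_partial \<kappa> p \<alpha> x\<bar> \<le> 120 * \<kappa>\<^sup>2"
proof (cases "dist x p < 1 / (2 * \<kappa>)")
  case False
  then show ?thesis using assms bump_partial_support[of \<kappa> x p \<alpha>] by simp
next
  case True
  define w where "w = bump_profile \<kappa> p x"
  have w: "0 \<le> w" "w \<le> 1"
    using assms by (auto simp: w_def bump_profile_def)
  have k2: "1 \<le> \<kappa>\<^sup>2" using assms by simp
  have y: "\<bar>2 * \<kappa> * (x - p) $ i\<bar> \<le> 1" for i
  proof -
    have "\<bar>(x - p) $ i\<bar> \<le> 1 / (2 * \<kappa>)"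
      using component_le_norm_cart[of "x - p" i] True by (simp add: dist_norm)
    then show ?thesis
      using assms(1) unfolding abs_mult by (simp add: field_simps)
  qed
  have w2: "\<bar>w\<^sup>2\<bar> \<le> 1" using w by (simp add: power_le_one)
  show ?thesis
  proof (cases "(\<kappa>, p, \<alpha>, x)" rule: bump_partial.cases)
    case (1 \<kappa> p x)
    then have "\<bar>bump_partial \<kappa> p \<alpha> x\<bar> \<le> 1"
      using w by (simp add: w_def power_le_one)
    then show ?thesis using k2 1 by simp
  next
    case (2 \<kappa>' p' i x')
    have "\<bar>bump_partial \<kappa> p \<alpha> x\<bar> = 12 * \<kappa> * (\<bar>w\<^sup>2\<bar> * \<bar>2 * \<kappa> * (x - p) $ i\<bar>)"
      using 2 assms(1) by (simp add: w_def abs_mult power2_eq_square)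
    also have "\<dots> \<le> 12 * \<kappa> * (1 * 1)"
      using assms(1) w2 y[of i] by (intro mult_left_mono mult_mono) auto
    also have "\<dots> \<le> 120 * \<kappa>\<^sup>2"
      using assms(1) by (simp add: power2_eq_square)
    finally show ?thesis .
  next
    case (3 \<kappa>' p' j i x')
    let ?a = "w * (2 * \<kappa> * (x - p) $ i) * (2 * \<kappa> * (x - p) $ j)"
    let ?b = "w\<^sup>2 * (if i = j then 1 else 0)"
    have "\<bar>?a\<bar> \<le> 1 * 1 * 1"
      unfolding abs_mult[of "w * _"] abs_mult[of w]
      using w y[of i] y[of j] by (intro mult_mono) auto
    moreover have "\<bar>?b\<bar> \<le> 1" using w2 by simp
    ultimately have "\<bar>96 * ?a - 24 * ?b\<bar> \<le> 120" by linarith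
    then have "\<kappa>\<^sup>2 * \<bar>96 * ?a - 24 * ?b\<bar> \<le> \<kappa>\<^sup>2 * 120" by (intro mult_left_mono) auto
    moreover have "bump_partial \<kappa> p \<alpha> x = \<kappa>\<^sup>2 * (96 * ?a - 24 * ?b)"
      using 3 by (simp add: w_def eval_nat_numeral algebra_simps)
    ultimately show ?thesis by (simp add: abs_mult mult.commute)
  qed (use assms in auto)
qed

text \<open>On a \<open>1 / \<kappa>\<close>-separated set, values of size \<open>B / (120 * \<kappa>\<^sup>2)\<close> can be prescribed to a
  perturbation of \<open>C\<^sup>2\<close> norm at most \<open>B\<close>: no two bumps are nonzero at the same point, so their sizes do not
  add up.\<close>

lemma C2_interpolation:
  fixes P :: "(real ^ 'd::finite) set" and v :: "real ^ 'd \<Rightarrow> 'b::real_normed_vector"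
    and \<phi> :: "real ^ 'd \<Rightarrow> 'b"
  assumes \<phi>: "C_k_on 2 (cube 1) \<phi>"
    and "finite P" and \<kappa>: "\<kappa> \<ge> 1" and "B \<ge> 0"
    and sep: "\<And>p p'. p \<in> P \<Longrightarrow> p' \<in> P \<Longrightarrow> p \<noteq> p' \<Longrightarrow> dist p p' \<ge> 1 / \<kappa>"
    and v: "\<And>p. p \<in> P \<Longrightarrow> norm (v p) \<le> B / (120 * \<kappa>\<^sup>2)"
  obtains \<psi> where "C_k_on 2 (cube 1) \<psi>" "C2_norm (\<lambda>x. \<phi> x - \<psi> x) \<le> B"
    "\<forall>p\<in>P. \<psi> p = \<phi> p + v p"
proof -
  define D where "D \<alpha> x = (\<Sum>p\<in>P. bump_partial \<kappa> p \<alpha> x *\<^sub>R v p)" for \<alpha> x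
  have der: "((\<lambda>s. D \<alpha> (x + s *\<^sub>R axis i 1)) has_vector_derivative D (i # \<alpha>) x) (at 0 within S)"
    if "length \<alpha> < 2" for \<alpha> i x S
    unfolding D_def
  proof (rule has_vector_derivative_sum)
    fix p
    show "((\<lambda>s. bump_partial \<kappa> p \<alpha> (x + s *\<^sub>R axis i 1) *\<^sub>R v p) has_vector_derivative
        bump_partial \<kappa> p (i # \<alpha>) x *\<^sub>R v p) (at 0 within S)"
      using has_vector_derivative_scaleR[OF has_field_derivative_at_within[OF bump_partial_deriv[OF that]]
          has_vector_derivative_const[of "v p"]]
      by simp
  qed
  have cont: "continuous_on (cube 1) (D \<alpha>)" for \<alpha>
    unfolding D_def by (intro continuous_intros continuous_on_bump_partial)
  have single: "D \<alpha> x = bump_partial \<kappa> p \<alpha> x *\<^sub>R v p" if "p \<in> P" "dist x p < 1 / (2 * \<kappa>)" for \<alpha> x p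
  proof -
    have "bump_partial \<kappa> p' \<alpha> x = 0" if p': "p' \<in> P - {p}" for p'
    proof (rule bump_partial_support)
      have "1 / \<kappa> \<le> dist p p'" using sep[of p p'] p' \<open>p \<in> P\<close> by auto
      also have "\<dots> \<le> dist x p + dist x p'" by (metis dist_commute dist_triangle)
      finally show "1 / (2 * \<kappa>) \<le> dist x p'" using \<open>dist x p < _\<close> \<kappa> by (simp add: field_simps)
    qed (use \<kappa> in auto)
    then have "D \<alpha> x = (\<Sum>p\<in>{p}. bump_partial \<kappa> p \<alpha> x *\<^sub>R v p)"
      unfolding D_def by (intro sum.mono_neutral_right) (use \<open>finite P\<close> \<open>p \<in> P\<close> in auto)
    then show ?thesis by simp
  qed
  have bound: "norm (D \<alpha> x) \<le> B" if "length \<alpha> \<le> 2" for \<alpha> x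
  proof (cases "\<exists>p\<in>P. dist x p < 1 / (2 * \<kappa>)")
    case True
    then obtain p where p: "p \<in> P" "dist x p < 1 / (2 * \<kappa>)" by blast
    have "norm (D \<alpha> x) = \<bar>bump_partial \<kappa> p \<alpha> x\<bar> * norm (v p)"
      using single[OF p] by simp
    also have "\<dots> \<le> (120 * \<kappa>\<^sup>2) * (B / (120 * \<kappa>\<^sup>2))"
      using \<kappa> v[OF p(1)] bump_partial_bound[OF \<kappa> that] by (intro mult_mono) auto
    also have "\<dots> = B" using \<kappa> by simp
    finally show ?thesis .
  next
    case False
    then have "bump_partial \<kappa> p \<alpha> x = 0" if "p \<in> P" for p
      using that \<kappa> by (intro bump_partial_support) (auto simp: not_less)
    then have "D \<alpha> x = 0" unfolding D_def by (intro sum.neutral) simp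
    then show ?thesis using \<open>B \<ge> 0\<close> by simp
  qed
  define E where "E \<alpha> x = iter_partial (cube 1) \<alpha> \<phi> x + D \<alpha> x" for \<alpha> x
  have "C_k_on 2 (cube 1) (E [])"
  proof (rule C_k_on_family)
    fix \<alpha> :: "'d list" and i and x :: "real ^ 'd" assume "length \<alpha> < 2" "x \<in> cube 1"
    then show "((\<lambda>s. E \<alpha> (x + s *\<^sub>R axis i 1)) has_vector_derivative E (i # \<alpha>) x)
        (at 0 within {s. x + s *\<^sub>R axis i 1 \<in> cube 1})"
      unfolding E_def
      by (intro has_vector_derivative_add C_k_on_cube_partial[OF \<phi>] der)
  next
    fix \<alpha> :: "'d list" assume "length \<alpha> \<le> 2"
    then show "continuous_on (cube 1) (E \<alpha>)"
      unfolding E_def using \<phi> by (intro continuous_on_add cont) (auto simp: C_k_on_def)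
  qed
  moreover have "C2_norm (\<lambda>x. \<phi> x - E [] x) \<le> B"
  proof (rule C2_norm_leI)
    fix \<alpha> :: "'d list" and x :: "real ^ 'd" assume *: "length \<alpha> \<le> 2" "x \<in> cube 1"
    have "(\<lambda>x. \<phi> x - E [] x) = (\<lambda>\<alpha> x. - D \<alpha> x) []"
      by (simp add: E_def)
    moreover have "iter_partial (cube 1) \<alpha> ((\<lambda>\<alpha> x. - D \<alpha> x) []) x = - D \<alpha> x"
      by (rule iter_partial_family[where k = 2]) (use * in \<open>auto intro!: has_vector_derivative_minus der\<close>)
    ultimately show "norm (iter_partial (cube 1) \<alpha> (\<lambda>x. \<phi> x - E [] x) x) \<le> B"
      using bound[OF *(1)] by simp
  qed
  moreover have "E [] p = \<phi> p + v p" if "p \<in> P" for p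
    using single[OF that, of p "[]"] \<kappa> by (simp add: E_def bump_profile_def)
  ultimately show ?thesis using that by blast
qed

section \<open>Exponential sums and their maximal function\<close>

lemma vec_set_card:
  assumes "finite A"
  shows "finite {q :: 'a ^ 'n::finite. \<forall>i. q $ i \<in> A}"
    and "card {q :: 'a ^ 'n::finite. \<forall>i. q $ i \<in> A} = card A ^ CARD('n)"
proof -
  have bij: "bij_betw vec_nth {q :: 'a ^ 'n. \<forall>i. q $ i \<in> A} (PiE UNIV (\<lambda>_. A))"
    by (rule bij_betwI[where g = vec_lambda]) auto
  show "finite {q :: 'a ^ 'n. \<forall>i. q $ i \<in> A}"
    using bij_betw_finite[OF bij] assms by (simp add: finite_PiE)
  show "card {q :: 'a ^ 'n. \<forall>i. q $ i \<in> A} = card A ^ CARD('n)"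
    using bij_betw_same_card[OF bij] by (simp add: card_PiE)
qed

lemma finite_grid: "finite (grid Q)"
  unfolding grid_def by (rule vec_set_card) simp

lemma norm_e [simp]: "cmod (e z) = 1"
  by (simp add: e_def norm_exp_eq_Re)

lemma e_add_Ints:
  assumes "k \<in> \<int>"
  shows "e (z + k) = e z"
proof -
  obtain j :: int where j: "k = of_int j" using assms by (auto elim: Ints_cases)
  have "e k = 1"
    using exp_integer_2pi[of "of_int j"] by (simp add: e_def j mult_ac)
  then show ?thesis by (simp add: e_def exp_add distrib_left)
qed

lemma Re_e_ge_half:
  assumes "0 \<le> z" "z \<le> 1 / 6"
  shows "Re (e z) \<ge> 1 / 2"
proof -
  have "Re (e z) = cos (2 * pi * z)"
    by (simp add: e_def Re_exp mult_ac)
  also have "\<dots> \<ge> cos (pi / 3)"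
    using assms by (intro cos_monotone_0_pi_le) (auto simp: field_simps)
  finally show ?thesis by (simp add: cos_60)
qed

lemma cmod_exp_sum_le: "cmod (exp_sum Q b \<psi> x t) \<le> (\<Sum>q\<in>grid Q. cmod (b q))"
  unfolding exp_sum_def by (rule sum_norm_le) (simp add: norm_mult)

lemma bdd_above_exp_sum: "bdd_above ((\<lambda>t. cmod (exp_sum Q b \<psi> x t)) ` T)"
  using cmod_exp_sum_le by (auto intro!: bdd_aboveI2)

lemma zero_in_cube: "0 \<in> cube (real Q ^ 2)"
  by (simp add: mem_cube_iff)

lemma maximal_fn_ge:
  assumes "t \<in> cube (real Q ^ 2)"
  shows "cmod (exp_sum Q b \<psi> x t) \<le> maximal_fn Q b \<psi> x"
  unfolding maximal_fn_def by (rule cSUP_upper[OF assms bdd_above_exp_sum])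

lemma maximal_fn_le: "maximal_fn Q b \<psi> x \<le> (\<Sum>q\<in>grid Q. cmod (b q))"
  unfolding maximal_fn_def using zero_in_cube[of Q] cmod_exp_sum_le by (intro cSUP_least) blast+

lemma maximal_fn_nonneg: "0 \<le> maximal_fn Q b \<psi> x"
  using maximal_fn_ge[OF zero_in_cube] norm_ge_zero order_trans by blast

text \<open>A supremum of continuous functions is lower semicontinuous.\<close>

lemma borel_measurable_maximal_fn [measurable]: "maximal_fn Q b \<psi> \<in> borel_measurable borel"
proof (rule borel_measurableI_greater)
  fix a :: real
  have cont: "continuous_on UNIV (\<lambda>x. cmod (exp_sum Q b \<psi> x t))" for t
    unfolding exp_sum_def e_def by (intro continuous_intros)
  have "{x. a < maximal_fn Q b \<psi> x} = (\<Union>t\<in>cube (real Q ^ 2). {x. a < cmod (exp_sum Q b \<psi> x t)})"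
    unfolding maximal_fn_def
    by (subst less_cSUP_iff[OF _ bdd_above_exp_sum]) (use zero_in_cube in auto)
  moreover have "open \<dots>"
    by (intro open_UN ballI open_Collect_less continuous_on_const cont)
  ultimately show "{x \<in> space borel. a < maximal_fn Q b \<psi> x} \<in> sets borel"
    by simp
qed

text \<open>Measurability and boundedness of \<open>f\<close> are essential: the Bochner integral of a function that
  is not integrable is 0.\<close>

lemma Lp_norm_on_ge:
  fixes f :: "real ^ 'd \<Rightarrow> real"
  assumes f [measurable]: "f \<in> borel_measurable borel" and bd: "\<And>x. \<bar>f x\<bar> \<le> B"
    and [measurable]: "F \<in> sets borel" and F: "F \<subseteq> cube r"
    and H: "0 \<le> H" "\<And>x. x \<in> F \<Longrightarrow> H \<le> \<bar>f x\<bar>" and p: "p > 0"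
  shows "Lp_norm_on p (cube r) f \<ge> H * measure lborel F powr (1 / p)"
proof -
  have cube [measurable]: "cube r \<in> sets (borel :: (real ^ 'd) measure)"
    by (simp add: cube_def)
  have fin: "emeasure lborel (cube r :: (real ^ 'd) set) < \<infinity>"
    unfolding cube_def by (rule emeasure_lborel_cbox_finite)
  have finF: "emeasure lborel F < \<infinity>"
    using emeasure_mono[OF F, of lborel] fin by (auto intro: le_less_trans)
  have int: "integrable lborel (\<lambda>x. indicator (cube r) x *\<^sub>R \<bar>f x\<bar> powr p)"
    by (rule integrableI_bounded_set[where A = "cube r" and B = "B powr p"])
      (use fin bd p in \<open>auto intro!: powr_mono2 AE_I2\<close>)
  have "H powr p * measure lborel F = (\<integral>x. indicator F x *\<^sub>R (H powr p) \<partial>lborel)"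
    by (simp add: mult.commute)
  also have "\<dots> \<le> (\<integral>x. indicator (cube r) x *\<^sub>R \<bar>f x\<bar> powr p \<partial>lborel)"
  proof (rule integral_mono[OF _ int])
    show "integrable lborel (\<lambda>x. indicator F x *\<^sub>R H powr p)"
      using finF by auto
    show "indicator F x *\<^sub>R H powr p \<le> indicator (cube r) x *\<^sub>R \<bar>f x\<bar> powr p" for x
      using F H p by (auto simp: indicator_def intro!: powr_mono2)
  qed
  finally have "(H powr p * measure lborel F) powr (1 / p) \<le> Lp_norm_on p (cube r) f"
    unfolding Lp_norm_on_def set_lebesgue_integral_def using p by (intro powr_mono2) auto
  then show ?thesis
    using H(1) p by (simp add: powr_mult powr_powr)
qed

section \<open>Frequencies in a sparse sublattice\<close>

text \<open>The frequencies used: the points of the grid with coordinates divisible by \<open>R\<close>.\<close>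

definition subgrid :: "nat \<Rightarrow> nat \<Rightarrow> (nat ^ 'd) set" where
  "subgrid R Q = {q \<in> grid Q. \<forall>i. R dvd q $ i}"

lemma card_multiples_upto:
  assumes "R \<ge> (1::nat)"
  shows "card {a \<in> {1..Q}. R dvd a} = Q div R"
proof -
  have "{a \<in> {1..Q}. R dvd a} = (\<lambda>k. R * k) ` {1..Q div R}"
  proof (intro equalityI subsetI)
    fix a assume a: "a \<in> {a \<in> {1..Q}. R dvd a}"
    then obtain k where k: "a = R * k" by auto
    then have "k \<le> Q div R" using a assms by (simp add: less_eq_div_iff_mult_less_eq mult.commute)
    moreover have "1 \<le> k" using a k by (cases k) auto
    ultimately show "a \<in> (\<lambda>k. R * k) ` {1..Q div R}" unfolding k by (intro imageI) simp
  next
    fix a assume "a \<in> (\<lambda>k. R * k) ` {1..Q div R}"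
    then show "a \<in> {a \<in> {1..Q}. R dvd a}"
      using assms by (auto simp: less_eq_div_iff_mult_less_eq mult.commute)
  qed
  then show ?thesis
    using assms by (simp add: card_image inj_on_def)
qed

lemma card_subgrid:
  assumes "R \<ge> 1"
  shows "finite (subgrid R Q :: (nat ^ 'd) set)"
    and "card (subgrid R Q :: (nat ^ 'd) set) = (Q div R) ^ CARD('d)"
proof -
  have "(subgrid R Q :: (nat ^ 'd) set) = {q. \<forall>i. q $ i \<in> {a \<in> {1..Q}. R dvd a}}"
    by (auto simp: subgrid_def grid_def)
  then show "finite (subgrid R Q :: (nat ^ 'd) set)"
      "card (subgrid R Q :: (nat ^ 'd) set) = (Q div R) ^ CARD('d)"
    using vec_set_card[of "{a \<in> {1..Q}. R dvd a}"] card_multiples_upto[OF assms]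
    by (simp_all del: mem_Collect_eq)
qed

lemma l2_norm_subgrid:
  "l2_norm Q (indicator (subgrid R Q :: (nat ^ 'd) set)) = sqrt (real (card (subgrid R Q :: (nat ^ 'd) set)))"
proof -
  have "(\<Sum>q\<in>(grid Q :: (nat ^ 'd) set). (cmod (indicator (subgrid R Q) q))\<^sup>2)
      = (\<Sum>q\<in>(subgrid R Q :: (nat ^ 'd) set). 1 :: real)"
    by (rule sum.mono_neutral_cong_right) (auto simp: finite_grid subgrid_def indicator_def)
  then show ?thesis by (simp add: l2_norm_def)
qed

lemma scaled_in_cube:
  assumes "q \<in> grid Q"
  shows "0 \<le> scaled Q q $ i" "scaled Q q $ i \<le> 1"
  using assms by (auto simp: grid_def scaled_def divide_le_eq_1)

lemma dist_scaled_subgrid: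
  assumes "q \<in> subgrid R Q" "q' \<in> subgrid R Q" "q \<noteq> q'"
  shows "dist (scaled Q q) (scaled Q q') \<ge> real R / real Q"
proof -
  obtain i where i: "q $ i \<noteq> q' $ i" using assms(3) by (auto simp: vec_eq_iff)
  have "int R dvd int (q $ i) - int (q' $ i)"
    using assms(1,2) by (intro dvd_diff) (auto simp: subgrid_def)
  then have "int R \<le> \<bar>int (q $ i) - int (q' $ i)\<bar>"
    using i zdvd_imp_le[of "int R" "\<bar>int (q $ i) - int (q' $ i)\<bar>"] by auto
  then have R: "real R \<le> \<bar>real (q $ i) - real (q' $ i)\<bar>" by linarith
  have "real R / real Q \<le> \<bar>(scaled Q q - scaled Q q') $ i\<bar>"
    using divide_right_mono[OF R, of "real Q"]
    by (simp add: scaled_def diff_divide_distrib[symmetric])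
  also have "\<dots> \<le> dist (scaled Q q) (scaled Q q')"
    unfolding dist_norm by (rule component_le_norm_cart)
  finally show ?thesis .
qed

text \<open>The vector \<open>\<tau>\<close>, transported along an injective \<open>\<iota>\<close> to the coordinates of the larger
  space, with entry 0 outside the range of \<open>\<iota>\<close>.\<close>

definition embed_vec :: "('m \<Rightarrow> 'd) \<Rightarrow> nat ^ 'm \<Rightarrow> 'd \<Rightarrow> nat" where
  "embed_vec \<iota> \<tau> i = (if i \<in> range \<iota> then \<tau> $ inv \<iota> i else 0)"

lemma sum_embed_vec:
  fixes \<iota> :: "'m::finite \<Rightarrow> 'd::finite" and f :: "'d \<Rightarrow> real"
  assumes "inj \<iota>"
  shows "(\<Sum>i\<in>UNIV. real (embed_vec \<iota> \<tau> i) * f i) = (\<Sum>j\<in>UNIV. real (\<tau> $ j) * f (\<iota> j))"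
proof -
  have "(\<Sum>i\<in>UNIV. real (embed_vec \<iota> \<tau> i) * f i) = (\<Sum>i\<in>range \<iota>. real (embed_vec \<iota> \<tau> i) * f i)"
    by (rule sum.mono_neutral_right) (auto simp: embed_vec_def)
  also have "\<dots> = (\<Sum>j\<in>UNIV. real (\<tau> $ j) * f (\<iota> j))"
    using assms by (simp add: sum.reindex embed_vec_def)
  finally show ?thesis .
qed

text \<open>If the values of \<open>\<psi>\<close> at the frequencies are linear modulo a lattice of mesh \<open>\<eta> / \<kappa>\<^sup>2\<close>, then
  for \<open>t = (\<kappa>\<^sup>2 / \<eta>) * \<tau>\<close> the phase \<open>t \<bullet> \<psi>\<close> is linear modulo 1 and amounts to a translation
  by \<open>- \<tau>\<close> in \<open>x\<close>. So the points of \<open>\<kappa> * \<int>\<^sup>d\<close>, where the sum is resonant for \<open>t = 0\<close>,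
  are joined by their translates by \<open>\<tau>\<close>. A box of side \<open>1 / (6 * d)\<close> with such a point as lower corner keeps all
  phases in \<open>[0, 1/6]\<close>, where the cosine is at least \<open>1/2\<close>.\<close>

lemma maximal_fn_resonance:
  fixes \<psi> :: "real ^ 'd \<Rightarrow> real ^ 'm" and \<iota> :: "'m::finite \<Rightarrow> 'd::finite" and \<tau> :: "nat ^ 'm" and u :: "nat ^ 'd"
  assumes "inj \<iota>" and R: "R \<ge> 1" and Q: "Q \<ge> 1" and \<eta>: "\<eta> > 0" and \<kappa>: "\<kappa> = real Q / real R"
    and aff: "\<And>q j. q \<in> subgrid R Q \<Longrightarrow> \<kappa>\<^sup>2 / \<eta> * \<psi> (scaled Q q) $ j + scaled Q q $ \<iota> j \<in> \<int>"
    and \<tau>: "\<And>j. real (\<tau> $ j) \<le> \<eta> * (real R)\<^sup>2"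
    and x: "\<And>i. 0 \<le> x $ i - \<kappa> * real (u $ i) - real (embed_vec \<iota> \<tau> i)"
      "\<And>i. x $ i - \<kappa> * real (u $ i) - real (embed_vec \<iota> \<tau> i) \<le> 1 / (6 * real CARD('d))"
  shows "real (card (subgrid R Q :: (nat ^ 'd) set)) / 2 \<le> maximal_fn Q (indicator (subgrid R Q)) \<psi> x"
proof -
  define t :: "real ^ 'm" where "t = (\<chi> j. \<kappa>\<^sup>2 / \<eta> * real (\<tau> $ j))"
  have "t \<in> cube (real Q ^ 2)"
    unfolding mem_cube_iff
  proof (intro allI conjI)
    fix j
    show "0 \<le> t $ j" using \<eta> by (simp add: t_def)
    have "t $ j \<le> \<kappa>\<^sup>2 / \<eta> * (\<eta> * (real R)\<^sup>2)"
      unfolding t_def using \<tau>[of j] \<eta> by (simp only: vec_lambda_beta) (intro mult_left_mono, auto)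
    also have "\<dots> = (real Q)\<^sup>2"
      using \<eta> R by (simp add: \<kappa> power_divide)
    finally show "t $ j \<le> real Q ^ 2" .
  qed
  moreover have "real (card (subgrid R Q :: (nat ^ 'd) set)) / 2
      \<le> cmod (exp_sum Q (indicator (subgrid R Q)) \<psi> x t)"
  proof -
    have phase: "Re (e (x \<bullet> scaled Q q + t \<bullet> \<psi> (scaled Q q))) \<ge> 1 / 2" if q: "q \<in> subgrid R Q" for q
    proof -
      define \<xi> where "\<xi> = scaled Q q"
      define y where "y i = x $ i - \<kappa> * real (u $ i) - real (embed_vec \<iota> \<tau> i)" for i
      have \<xi>: "0 \<le> \<xi> $ i" "\<xi> $ i \<le> 1" for i
        using q scaled_in_cube[of q Q] by (auto simp: \<xi>_def subgrid_def)
      have int1: "(\<Sum>i\<in>UNIV. \<kappa> * real (u $ i) * \<xi> $ i) \<in> \<int>"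
      proof (rule Ints_sum)
        fix i
        obtain k where k: "q $ i = R * k" using q by (auto simp: subgrid_def)
        have "\<kappa> * real (u $ i) * \<xi> $ i = real (u $ i * k)"
          using R Q by (simp add: \<kappa> \<xi>_def scaled_def k)
        then show "\<kappa> * real (u $ i) * \<xi> $ i \<in> \<int>" by (metis Ints_of_nat)
      qed
      have int2: "(\<Sum>j\<in>UNIV. real (\<tau> $ j) * (\<kappa>\<^sup>2 / \<eta> * \<psi> \<xi> $ j + \<xi> $ \<iota> j)) \<in> \<int>"
        using aff[OF q] by (intro Ints_sum Ints_mult) (auto simp: \<xi>_def)
      have "x \<bullet> \<xi> = (\<Sum>i\<in>UNIV. y i * \<xi> $ i) + (\<Sum>i\<in>UNIV. \<kappa> * real (u $ i) * \<xi> $ i)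
           + (\<Sum>i\<in>UNIV. real (embed_vec \<iota> \<tau> i) * \<xi> $ i)"
        unfolding inner_vec_def sum.distrib[symmetric]
        by (rule sum.cong) (simp_all add: y_def algebra_simps)
      moreover have "t \<bullet> \<psi> \<xi> + (\<Sum>i\<in>UNIV. real (embed_vec \<iota> \<tau> i) * \<xi> $ i)
          = (\<Sum>j\<in>UNIV. real (\<tau> $ j) * (\<kappa>\<^sup>2 / \<eta> * \<psi> \<xi> $ j + \<xi> $ \<iota> j))"
        unfolding inner_vec_def sum_embed_vec[OF \<open>inj \<iota>\<close>] sum.distrib[symmetric]
        by (rule sum.cong) (simp_all add: t_def algebra_simps)
      ultimately have "x \<bullet> \<xi> + t \<bullet> \<psi> \<xi> = (\<Sum>i\<in>UNIV. y i * \<xi> $ i) +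
          ((\<Sum>i\<in>UNIV. \<kappa> * real (u $ i) * \<xi> $ i)
           + (\<Sum>j\<in>UNIV. real (\<tau> $ j) * (\<kappa>\<^sup>2 / \<eta> * \<psi> \<xi> $ j + \<xi> $ \<iota> j)))"
        by linarith
      then have "e (x \<bullet> \<xi> + t \<bullet> \<psi> \<xi>) = e (\<Sum>i\<in>UNIV. y i * \<xi> $ i)"
        using e_add_Ints[OF Ints_add[OF int1 int2]] by simp
      moreover have "0 \<le> (\<Sum>i\<in>UNIV. y i * \<xi> $ i)"
        using x(1) \<xi> by (intro sum_nonneg mult_nonneg_nonneg) (auto simp: y_def)
      moreover have "(\<Sum>i\<in>UNIV. y i * \<xi> $ i) \<le> (\<Sum>i\<in>(UNIV::'d set). 1 / (6 * real CARD('d)) * 1)"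
        using x \<xi> by (intro sum_mono mult_mono) (auto simp: y_def)
      ultimately show ?thesis
        using Re_e_ge_half[of "\<Sum>i\<in>UNIV. y i * \<xi> $ i"] by (simp add: \<xi>_def)
    qed
    have "real (card (subgrid R Q :: (nat ^ 'd) set)) / 2 = (\<Sum>q\<in>(subgrid R Q :: (nat ^ 'd) set). 1 / 2)"
      by simp
    also have "\<dots> \<le> (\<Sum>q\<in>subgrid R Q. Re (e (x \<bullet> scaled Q q + t \<bullet> \<psi> (scaled Q q))))"
      by (intro sum_mono phase)
    also have "\<dots> = Re (exp_sum Q (indicator (subgrid R Q)) \<psi> x t)"
      unfolding exp_sum_def Re_sum
      by (rule sum.mono_neutral_cong_left) (auto simp: finite_grid subgrid_def indicator_def)
    also have "\<dots> \<le> cmod (exp_sum Q (indicator (subgrid R Q)) \<psi> x t)"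
      by (rule complex_Re_le_cmod)
    finally show ?thesis .
  qed
  ultimately show ?thesis
    using maximal_fn_ge order_trans by blast
qed

text \<open>The small boxes attached to distinct pairs \<open>(u, \<tau>)\<close> are disjoint as long as the entries of
  \<open>\<tau>\<close> stay below \<open>\<kappa> - \<delta>\<close>, which gives the measure of the set of resonant points.\<close>

lemma resonant_set:
  fixes \<iota> :: "'m::finite \<Rightarrow> 'd::finite" and \<kappa> \<delta> :: real
  assumes "inj \<iota>" and \<delta>: "0 \<le> \<delta>" "\<delta> < 1" and T: "real T + \<delta> < \<kappa>"
  obtains F :: "(real ^ 'd) set"
  where "F \<in> sets borel" "F \<subseteq> cube (\<kappa> * real R)"
    "measure lborel F = real R ^ CARD('d) * real (T + 1) ^ CARD('m) * \<delta> ^ CARD('d)"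
    "\<And>x. x \<in> F \<Longrightarrow> \<exists>(u :: nat ^ 'd) (\<tau> :: nat ^ 'm). (\<forall>j. \<tau> $ j \<le> T) \<and>
       (\<forall>i. 0 \<le> x $ i - \<kappa> * real (u $ i) - real (embed_vec \<iota> \<tau> i) \<and>
            x $ i - \<kappa> * real (u $ i) - real (embed_vec \<iota> \<tau> i) \<le> \<delta>)"
proof -
  define I where "I = {u :: nat ^ 'd. \<forall>i. u $ i \<in> {..<R}} \<times> {\<tau> :: nat ^ 'm. \<forall>j. \<tau> $ j \<in> {..T}}"
  define c :: "(nat ^ 'd) \<times> (nat ^ 'm) \<Rightarrow> real ^ 'd"
    where "c z = (\<chi> i. \<kappa> * real (fst z $ i) + real (embed_vec \<iota> (snd z) i))" for z
  define box where "box z = cbox (c z) (c z + vec \<delta>)" for z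
  have mem: "x \<in> box z \<longleftrightarrow> (\<forall>i. 0 \<le> x $ i - \<kappa> * real (fst z $ i) - real (embed_vec \<iota> (snd z) i) \<and>
            x $ i - \<kappa> * real (fst z $ i) - real (embed_vec \<iota> (snd z) i) \<le> \<delta>)" for x z
    unfolding box_def mem_box_cart by (auto simp: c_def algebra_simps)
  have "finite I" and cardI: "card I = R ^ CARD('d) * (T + 1) ^ CARD('m)"
    unfolding I_def using vec_set_card[of "{..<R}", where 'n = 'd] vec_set_card[of "{..T}", where 'n = 'm]
    by (auto simp: card_cartesian_product)
  have emb: "real (embed_vec \<iota> \<tau> i) \<le> real T" if "\<forall>j. \<tau> $ j \<in> {..T}" for \<tau> i
    using that by (auto simp: embed_vec_def)
  have \<kappa>0: "0 < \<kappa>" using T \<delta> by linarith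
  have less: False if "x \<in> box (u, \<tau>)" "x \<in> box (u', \<tau>')" "\<forall>j. \<tau> $ j \<in> {..T}" "u $ i < u' $ i"
    for x u \<tau> u' \<tau>' i
  proof -
    have "\<kappa> * (real (u $ i) + 1) \<le> \<kappa> * real (u' $ i)"
      using that(4) \<kappa>0 by (intro mult_left_mono) auto
    also have "\<dots> \<le> x $ i" using that(2)[unfolded mem, rule_format, of i] by simp
    also have "\<dots> \<le> \<kappa> * real (u $ i) + real T + \<delta>"
      using that(1)[unfolded mem, rule_format, of i] emb[OF that(3), of i] by simp
    finally show False using T by (simp add: algebra_simps)
  qed
  have disj: "disjoint_family_on box I"
    unfolding disjoint_family_on_def
  proof (intro ballI impI, rule ccontr)
    fix z z' assume z: "z \<in> I" "z' \<in> I" "z \<noteq> z'" "box z \<inter> box z' \<noteq> {}"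
    obtain u \<tau> u' \<tau>' where zz: "z = (u, \<tau>)" "z' = (u', \<tau>')" by (cases z, cases z')
    obtain x where x: "x \<in> box (u, \<tau>)" "x \<in> box (u', \<tau>')" using z zz by auto
    have "\<not> u $ i < u' $ i" "\<not> u' $ i < u $ i" for i
      using less[of x u \<tau> u' \<tau>' i] less[of x u' \<tau>' u \<tau> i] x z zz by (auto simp: I_def)
    then have u: "u = u'" by (metis linorder_neqE_nat vec_eq_iff)
    have "\<tau> $ j = \<tau>' $ j" for j
    proof -
      have "embed_vec \<iota> \<sigma> (\<iota> j) = \<sigma> $ j" for \<sigma>
        using \<open>inj \<iota>\<close> by (simp add: embed_vec_def)
      then have "\<bar>real (\<tau> $ j) - real (\<tau>' $ j)\<bar> < 1"
        using x[unfolded mem, THEN spec[of _ "\<iota> j"]] u \<delta> by simp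
      then show ?thesis by linarith
    qed
    then show False using z(3) zz u by (simp add: vec_eq_iff)
  qed
  let ?F = "\<Union>z\<in>I. box z"
  have "measure lborel ?F = (\<Sum>z\<in>I. measure lborel (box z))"
    by (rule measure_finite_Union[OF \<open>finite I\<close> _ disj])
      (auto simp: box_def emeasure_lborel_cbox_eq)
  also have "\<dots> = (\<Sum>z\<in>I. \<delta> ^ CARD('d))"
  proof (rule sum.cong[OF refl])
    fix z
    have "cbox (c z) (c z + vec \<delta>) \<noteq> {}"
      using \<delta> by (simp add: interval_ne_empty_cart)
    then show "measure lborel (box z) = \<delta> ^ CARD('d)"
      unfolding box_def by (simp add: content_cbox_cart)
  qed
  finally have meas: "measure lborel ?F = real R ^ CARD('d) * real (T + 1) ^ CARD('m) * \<delta> ^ CARD('d)"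
    using cardI by simp
  have "?F \<subseteq> cube (\<kappa> * real R)"
  proof
    fix x assume "x \<in> ?F"
    then obtain u \<tau> where z: "(u, \<tau>) \<in> I" "x \<in> box (u, \<tau>)" by auto
    have "0 \<le> x $ i \<and> x $ i \<le> \<kappa> * real R" for i
    proof -
      have "0 \<le> \<kappa> * real (u $ i)" using \<kappa>0 by simp
      moreover have "\<kappa> * (real (u $ i) + 1) \<le> \<kappa> * real R"
      proof (intro mult_left_mono)
        have "u $ i < R" using z(1) by (simp add: I_def)
        then show "real (u $ i) + 1 \<le> real R" by linarith
      qed (use \<kappa>0 in simp)
      moreover have "real (embed_vec \<iota> \<tau> i) \<le> real T" using z(1) by (intro emb) (auto simp: I_def)
      moreover have "0 \<le> x $ i - \<kappa> * real (u $ i) - real (embed_vec \<iota> \<tau> i)"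
          "x $ i - \<kappa> * real (u $ i) - real (embed_vec \<iota> \<tau> i) \<le> \<delta>"
        using z(2)[unfolded mem, THEN spec[of _ i]] by simp_all
      ultimately show ?thesis
        using T by (simp only: distrib_left mult_1_right) linarith
    qed
    then show "x \<in> cube (\<kappa> * real R)" by (simp add: mem_cube_iff)
  qed
  moreover have "?F \<in> sets borel"
    using \<open>finite I\<close> by (intro sets.finite_UN) (auto simp: box_def)
  moreover have "\<exists>(u :: nat ^ 'd) (\<tau> :: nat ^ 'm). (\<forall>j. \<tau> $ j \<le> T) \<and>
       (\<forall>i. 0 \<le> x $ i - \<kappa> * real (u $ i) - real (embed_vec \<iota> \<tau> i) \<and>
            x $ i - \<kappa> * real (u $ i) - real (embed_vec \<iota> \<tau> i) \<le> \<delta>)" if "x \<in> ?F" for x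
    using that unfolding I_def by (auto simp: mem)
  ultimately show ?thesis using that meas by blast
qed

text \<open>A map \<open>\<psi>\<close> close to \<open>\<phi>\<close> with values at the frequencies that are linear modulo a lattice of
  mesh \<open>\<eta> / \<kappa>\<^sup>2\<close>: round up the values of \<open>\<phi>\<close>. The frequencies are \<open>1 / \<kappa>\<close>-separated, so this
  mesh is small enough for the interpolation.\<close>

lemma rounded_function:
  fixes \<phi> :: "real ^ 'd \<Rightarrow> real ^ 'm" and \<iota> :: "'m::finite \<Rightarrow> 'd::finite"
  assumes \<phi>: "C_k_on 2 (cube 1) \<phi>" and R: "1 \<le> R" "R \<le> Q" and \<kappa>: "\<kappa> = real Q / real R"
    and \<eta>: "\<eta> > 0" "120 * real CARD('m) * \<eta> \<le> \<epsilon>"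
  obtains \<psi> where "C_k_on 2 (cube 1) \<psi>" "C2_norm (\<lambda>x. \<phi> x - \<psi> x) \<le> \<epsilon>"
    "\<And>q j. q \<in> subgrid R Q \<Longrightarrow> \<kappa>\<^sup>2 / \<eta> * \<psi> (scaled Q q) $ j + scaled Q q $ \<iota> j \<in> \<int>"
proof -
  define z where "z \<xi> j = \<kappa>\<^sup>2 / \<eta> * \<phi> \<xi> $ j + \<xi> $ \<iota> j" for \<xi> j
  define v :: "real ^ 'd \<Rightarrow> real ^ 'm"
    where "v \<xi> = (\<chi> j. \<eta> / \<kappa>\<^sup>2 * (of_int \<lceil>z \<xi> j\<rceil> - z \<xi> j))" for \<xi>
  have \<kappa>1: "\<kappa> \<ge> 1" using R by (simp add: \<kappa>)
  have vj: "\<bar>v \<xi> $ j\<bar> \<le> \<eta> / \<kappa>\<^sup>2" for \<xi> j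
  proof -
    have "\<bar>of_int \<lceil>z \<xi> j\<rceil> - z \<xi> j\<bar> \<le> 1" by linarith
    then have "\<eta> / \<kappa>\<^sup>2 * \<bar>of_int \<lceil>z \<xi> j\<rceil> - z \<xi> j\<bar> \<le> \<eta> / \<kappa>\<^sup>2 * 1"
      using \<eta>(1) by (intro mult_left_mono) auto
    then show ?thesis using \<eta>(1) by (simp add: v_def abs_mult)
  qed
  have v: "norm (v \<xi>) \<le> \<epsilon> / (120 * \<kappa>\<^sup>2)" for \<xi>
  proof -
    have "norm (v \<xi>) \<le> (\<Sum>j\<in>UNIV. \<bar>v \<xi> $ j\<bar>)" by (rule norm_le_l1_cart)
    also have "\<dots> \<le> (\<Sum>j\<in>(UNIV::'m set). \<eta> / \<kappa>\<^sup>2)" by (intro sum_mono vj)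
    also have "\<dots> = (120 * real CARD('m) * \<eta>) / (120 * \<kappa>\<^sup>2)" by simp
    also have "\<dots> \<le> \<epsilon> / (120 * \<kappa>\<^sup>2)" using \<eta>(2) by (intro divide_right_mono) auto
    finally show ?thesis .
  qed
  have fin: "finite (scaled Q ` (subgrid R Q :: (nat ^ 'd) set))"
    using card_subgrid(1)[OF R(1)] by blast
  have \<epsilon>: "0 \<le> \<epsilon>" using \<eta> by (smt (verit) mult_nonneg_nonneg of_nat_0_le_iff)
  have sep: "1 / \<kappa> \<le> dist p p'"
    if "p \<in> scaled Q ` (subgrid R Q :: (nat ^ 'd) set)" "p' \<in> scaled Q ` subgrid R Q" "p \<noteq> p'" for p p'
    using that dist_scaled_subgrid by (fastforce simp: \<kappa>)
  obtain \<psi> :: "real ^ 'd \<Rightarrow> real ^ 'm" where \<psi>: "C_k_on 2 (cube 1) \<psi>" "C2_norm (\<lambda>x. \<phi> x - \<psi> x) \<le> \<epsilon>"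
    "\<forall>p \<in> scaled Q ` (subgrid R Q :: (nat ^ 'd) set). \<psi> p = \<phi> p + v p"
    by (rule C2_interpolation[where v = v, OF \<phi> fin \<kappa>1 \<epsilon> sep v])
  have "\<kappa>\<^sup>2 / \<eta> * \<psi> (scaled Q q) $ j + scaled Q q $ \<iota> j \<in> \<int>"
    if q: "q \<in> subgrid R Q" for q j
  proof -
    have cancel: "\<kappa>\<^sup>2 / \<eta> * (\<eta> / \<kappa>\<^sup>2 * a) = a" for a
      using \<eta>(1) \<kappa>1 by simp
    have "\<psi> (scaled Q q) $ j
        = \<phi> (scaled Q q) $ j + \<eta> / \<kappa>\<^sup>2 * (of_int \<lceil>z (scaled Q q) j\<rceil> - z (scaled Q q) j)"
      using \<psi>(3) q by (simp add: v_def)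
    then have "\<kappa>\<^sup>2 / \<eta> * \<psi> (scaled Q q) $ j + scaled Q q $ \<iota> j = of_int \<lceil>z (scaled Q q) j\<rceil>"
      by (simp only: distrib_left cancel) (simp add: z_def)
    then show ?thesis by (simp only: Ints_of_int)
  qed
  then show ?thesis by (rule that[OF \<psi>(1,2)])
qed

section \<open>The lower bound\<close>

theorem theorem2p1:
  fixes n d m :: nat and A \<epsilon> :: real
  assumes "n \<ge> 2"
    and "real n / 2 \<le> real d" and "d < n"
    and "m = n - d"
    and "CARD('d::finite) = d" and "CARD('m::finite) = m"
    and "A > 0" and "\<epsilon> > 0"
  shows "\<exists>(Q0::nat) (c0::real). Q0 \<ge> 1 \<and> c0 > 0 \<and>
    (\<forall>\<phi> :: real ^ 'd \<Rightarrow> real ^ 'm. C_k_on 2 (cube 1) \<phi> \<and> C2_norm \<phi> \<le> A \<longrightarrow>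
      (\<forall>Q::nat. Q \<ge> Q0 \<longrightarrow>
        (\<exists>(\<psi> :: real ^ 'd \<Rightarrow> real ^ 'm) (b :: nat ^ 'd \<Rightarrow> complex).
          C_k_on 2 (cube 1) \<psi> \<and> C2_norm (\<lambda>\<xi>. \<phi> \<xi> - \<psi> \<xi>) \<le> \<epsilon> \<and>
          (\<exists>q\<in>grid Q. b q \<noteq> 0) \<and>
          (\<forall>p::real. p \<ge> 1 \<longrightarrow>
            Lp_norm_on p (cube (real Q)) (maximal_fn Q b \<psi>)
              \<ge> c0 * real Q powr (real d * real n / (2 * (real d + 2 * real m)) + real m / p)
                   * l2_norm Q b))))"
proof -
  have md: "m \<le> d" "m \<ge> 1" "d \<ge> 1" and nmd: "n = d + m" using assms(1-4) by linarith+
  obtain \<iota> :: "'m \<Rightarrow> 'd" where \<iota>: "inj \<iota>"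
    using card_le_inj[of "UNIV :: 'm set" "UNIV :: 'd set"] md assms(5,6) by auto
  define \<eta> where "\<eta> = min (1 / 2) (\<epsilon> / (120 * real m))"
  have \<eta>: "0 < \<eta>" "\<eta> \<le> 1 / 2" "120 * real CARD('m) * \<eta> \<le> \<epsilon>"
  proof -
    show "\<eta> \<le> 1 / 2" unfolding \<eta>_def by (rule min.cobounded1)
    have "\<eta> \<le> \<epsilon> / (120 * real m)" by (simp add: \<eta>_def)
    then show "120 * real CARD('m) * \<eta> \<le> \<epsilon>" using md assms(6) by (simp add: field_simps)
  qed (use md assms in \<open>auto simp: \<eta>_def\<close>)
  define \<delta> where "\<delta> = 1 / (6 * real d)"
  have \<delta>: "0 < \<delta>" "\<delta> \<le> 1 / 6" using md by (auto simp: \<delta>_def field_simps)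
  have \<delta>_eq: "\<delta> = 1 / (6 * real CARD('d))" by (simp add: \<delta>_def assms(5))
  define c1 where "c1 = (1 / 2) ^ (d + 2 * m) * \<eta> ^ m * \<delta> ^ d"
  have c1: "0 < c1" "c1 \<le> 1"
    using \<eta> \<delta> by (auto simp: c1_def intro!: mult_le_one power_le_one)
  define c0 where "c0 = c1 / 2 * (1 / 2) powr (real d / 2)"
  have "c0 > 0" using c1 by (simp add: c0_def)
  moreover have "\<exists>(\<psi> :: real ^ 'd \<Rightarrow> real ^ 'm) (b :: nat ^ 'd \<Rightarrow> complex).
          C_k_on 2 (cube 1) \<psi> \<and> C2_norm (\<lambda>\<xi>. \<phi> \<xi> - \<psi> \<xi>) \<le> \<epsilon> \<and>
          (\<exists>q\<in>grid Q. b q \<noteq> 0) \<and>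
          (\<forall>p::real. p \<ge> 1 \<longrightarrow>
            Lp_norm_on p (cube (real Q)) (maximal_fn Q b \<psi>)
              \<ge> c0 * real Q powr (real d * real n / (2 * (real d + 2 * real m)) + real m / p)
                   * l2_norm Q b)"
    if \<phi>: "C_k_on 2 (cube 1) \<phi>" and Q: "Q \<ge> 1" for \<phi> :: "real ^ 'd \<Rightarrow> real ^ 'm" and Q
  proof -
    define s where "s = real d + 2 * real m"
    have s: "s > 0" using md by (simp add: s_def)
    \<comment> \<open>The spacing is chosen so that \<open>\<rho> ^ d * (\<rho>\<^sup>2) ^ m\<close>, up to constants the number of resonant
      boxes, equals \<open>Q ^ m\<close>.\<close>
    define \<rho> where "\<rho> = real Q powr (real m / s)"
    define R where "R = nat \<lfloor>\<rho>\<rfloor>"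
    have \<rho>1: "1 \<le> \<rho>" unfolding \<rho>_def using Q s by (intro ge_one_powr_ge_zero) auto
    have R: "1 \<le> R" "real R \<le> \<rho>" "\<rho> / 2 \<le> real R"
    proof -
      have "1 \<le> \<lfloor>\<rho>\<rfloor>" using \<rho>1 by simp
      moreover from this have "real R = of_int \<lfloor>\<rho>\<rfloor>" by (simp add: R_def)
      ultimately show "1 \<le> R" "real R \<le> \<rho>" "\<rho> / 2 \<le> real R" by linarith+
    qed
    have "\<rho> \<le> real Q powr 1"
      unfolding \<rho>_def using Q md s by (intro powr_mono) (auto simp: s_def)
    then have RQ: "R \<le> Q" using R by simp
    define \<kappa> where "\<kappa> = real Q / real R"
    have \<kappa>1: "1 \<le> \<kappa>" using R RQ by (simp add: \<kappa>_def)
    have \<kappa>R: "\<kappa> * real R = real Q" using R by (simp add: \<kappa>_def)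
    have \<kappa>_ge: "real Q powr (real n / s) \<le> \<kappa>"
    proof -
      have "real Q powr (real n / s) = real Q powr (1 - real m / s)"
        using s by (simp add: s_def nmd field_simps)
      also have "\<dots> = real Q / \<rho>" using Q by (simp add: powr_diff \<rho>_def)
      also have "\<dots> \<le> \<kappa>" unfolding \<kappa>_def using R by (intro divide_left_mono) auto
      finally show ?thesis .
    qed
    \<comment> \<open>This is where \<open>m \<le> d\<close> enters: the translations do not wrap around the period \<open>\<kappa>\<close>. The
      bound \<open>\<eta> \<le> 1 / 2\<close> then leaves room for the side \<open>\<delta>\<close> of the boxes.\<close>
    have R2: "(real R)\<^sup>2 \<le> \<kappa>"
    proof -
      have "(real R)\<^sup>2 \<le> \<rho>\<^sup>2" using R by (intro power_mono) auto
      also have "\<dots> = real Q powr (2 * real m / s)"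
        using Q by (simp add: \<rho>_def powr_power mult.commute)
      also have "\<dots> \<le> real Q powr (real n / s)"
        using Q s md by (intro powr_mono divide_right_mono) (auto simp: nmd)
      finally show ?thesis using \<kappa>_ge by simp
    qed
    define T where "T = nat \<lfloor>\<eta> * (real R)\<^sup>2\<rfloor>"
    have "0 \<le> \<eta> * (real R)\<^sup>2" using \<eta> by simp
    then have T: "real T \<le> \<eta> * (real R)\<^sup>2" "\<eta> * (real R)\<^sup>2 \<le> real (T + 1)"
      unfolding T_def by linarith+
    have "\<eta> * (real R)\<^sup>2 \<le> 1 / 2 * \<kappa>" using \<eta> R2 by (intro mult_mono) auto
    then have T\<kappa>: "real T + \<delta> < \<kappa>" using T(1) \<delta> \<kappa>1 by linarith
    obtain \<psi> where \<psi>: "C_k_on 2 (cube 1) \<psi>" "C2_norm (\<lambda>x. \<phi> x - \<psi> x) \<le> \<epsilon>"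
      "\<And>q j. q \<in> subgrid R Q \<Longrightarrow> \<kappa>\<^sup>2 / \<eta> * \<psi> (scaled Q q) $ j + scaled Q q $ \<iota> j \<in> \<int>"
      using rounded_function[OF \<phi> R(1) RQ \<kappa>_def \<eta>(1,3), of \<iota>] by blast
    have \<delta>': "0 \<le> \<delta>" "\<delta> < 1" using \<delta> by auto
    obtain F :: "(real ^ 'd) set" where F: "F \<in> sets borel" "F \<subseteq> cube (real Q)"
      and measF: "measure lborel F = real R ^ d * real (T + 1) ^ m * \<delta> ^ d"
      and resF: "\<And>x. x \<in> F \<Longrightarrow> \<exists>(u :: nat ^ 'd) (\<tau> :: nat ^ 'm). (\<forall>j. \<tau> $ j \<le> T) \<and>
         (\<forall>i. 0 \<le> x $ i - \<kappa> * real (u $ i) - real (embed_vec \<iota> \<tau> i) \<and>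
              x $ i - \<kappa> * real (u $ i) - real (embed_vec \<iota> \<tau> i) \<le> \<delta>)"
      using resonant_set[OF \<iota> \<delta>' T\<kappa>, of R] unfolding \<kappa>R assms(5,6) by blast
    define b :: "nat ^ 'd \<Rightarrow> complex" where "b = indicator (subgrid R Q)"
    define N where "N = real (card (subgrid R Q :: (nat ^ 'd) set))"
    have N_eq: "N = real (Q div R) ^ d"
      unfolding N_def using card_subgrid(2)[OF R(1), where 'd = 'd] assms(5) by simp
    have large: "N / 2 \<le> \<bar>maximal_fn Q b \<psi> x\<bar>" if x: "x \<in> F" for x
    proof -
      obtain u :: "nat ^ 'd" and \<tau> :: "nat ^ 'm" where *: "\<And>j. \<tau> $ j \<le> T"
         "\<And>i. 0 \<le> x $ i - \<kappa> * real (u $ i) - real (embed_vec \<iota> \<tau> i)"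
         "\<And>i. x $ i - \<kappa> * real (u $ i) - real (embed_vec \<iota> \<tau> i) \<le> \<delta>"
        using resF[OF x] by blast
      have \<tau>: "real (\<tau> $ j) \<le> \<eta> * (real R)\<^sup>2" for j
        using *(1)[of j] T(1) by linarith
      have "N / 2 \<le> maximal_fn Q b \<psi> x"
        unfolding N_def b_def
        by (rule maximal_fn_resonance[OF \<iota> R(1) Q \<eta>(1) \<kappa>_def \<psi>(3) \<tau> *(2) *(3)[unfolded \<delta>_eq]])
      then show ?thesis by linarith
    qed
    have div_ge: "\<kappa> / 2 \<le> real (Q div R)"
    proof -
      have "1 \<le> Q div R" using R(1) RQ by (simp add: less_eq_div_iff_mult_less_eq)
      moreover have "\<kappa> < real (Q div R) + 1"
        using floor_correct[of \<kappa>] floor_divide_of_nat_eq[of Q R, where 'a = real]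
        by (simp add: \<kappa>_def)
      ultimately show ?thesis by linarith
    qed
    have sqrtN: "(1 / 2) powr (real d / 2) * real Q powr (real d * real n / (2 * s)) \<le> sqrt N"
    proof -
      have "(1 / 2) powr (real d / 2) * real Q powr (real d * real n / (2 * s))
          = (real Q powr (real n / s) / 2) powr (real d / 2)"
        by (simp add: powr_divide powr_powr mult_ac)
      also have "\<dots> \<le> (real (Q div R)) powr (real d / 2)"
        using \<kappa>_ge div_ge by (intro powr_mono2) auto
      also have "\<dots> = sqrt N"
        using div_ge \<kappa>1 by (simp add: N_eq powr_half_sqrt[symmetric] powr_powr powr_realpow[symmetric])
      finally show ?thesis .
    qed
    have meas: "c1 * real Q powr real m \<le> measure lborel F"
    proof -
      have "real Q powr real m = \<rho> ^ (d + 2 * m)"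
        using Q s by (simp add: \<rho>_def powr_power s_def)
      then have "c1 * real Q powr real m = (\<rho> / 2) ^ (d + 2 * m) * \<eta> ^ m * \<delta> ^ d"
        by (simp add: c1_def power_divide)
      also have "\<dots> \<le> real R ^ (d + 2 * m) * \<eta> ^ m * \<delta> ^ d"
        using \<rho>1 R(3) \<eta>(1) \<delta>(1) by (intro mult_right_mono power_mono) auto
      also have "\<dots> = real R ^ d * (\<eta> * (real R)\<^sup>2) ^ m * \<delta> ^ d"
        by (simp add: power_add power_mult power_mult_distrib)
      also have "\<dots> \<le> real R ^ d * real (T + 1) ^ m * \<delta> ^ d"
        using T(2) \<eta>(1) \<delta>(1) by (intro mult_right_mono mult_left_mono power_mono) auto
      finally show ?thesis unfolding measF .
    qed
    have "c0 * real Q powr (real d * real n / (2 * (real d + 2 * real m)) + real m / p) * l2_norm Q b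
          \<le> Lp_norm_on p (cube (real Q)) (maximal_fn Q b \<psi>)" if p: "p \<ge> 1" for p
    proof -
      have "c1 * real Q powr (real m / p) \<le> c1 powr (1 / p) * real Q powr (real m / p)"
        using powr_mono'[of "1 / p" 1 c1] c1 p by (intro mult_right_mono) auto
      also have "\<dots> = (c1 * real Q powr real m) powr (1 / p)"
        using c1 by (simp add: powr_mult powr_powr)
      also have "\<dots> \<le> measure lborel F powr (1 / p)"
        using meas c1 p by (intro powr_mono2) auto
      finally have V: "c1 * real Q powr (real m / p) \<le> measure lborel F powr (1 / p)" .
      have "c0 * real Q powr (real d * real n / (2 * (real d + 2 * real m)) + real m / p) * l2_norm Q b
          = ((1 / 2) powr (real d / 2) * real Q powr (real d * real n / (2 * s))) * sqrt N / 2
             * (c1 * real Q powr (real m / p))"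
        unfolding b_def l2_norm_subgrid N_def c0_def by (simp add: powr_add s_def)
      also have "\<dots> \<le> sqrt N * sqrt N / 2 * measure lborel F powr (1 / p)"
        using sqrtN V c1 by (intro mult_mono divide_right_mono mult_right_mono) (auto simp: N_def)
      also have "\<dots> = N / 2 * measure lborel F powr (1 / p)" by (simp add: N_def)
      also have "\<dots> \<le> Lp_norm_on p (cube (real Q)) (maximal_fn Q b \<psi>)"
      proof (rule Lp_norm_on_ge[OF borel_measurable_maximal_fn _ F _ large])
        show "\<bar>maximal_fn Q b \<psi> x\<bar> \<le> (\<Sum>q\<in>grid Q. cmod (b q))" for x
          using maximal_fn_nonneg maximal_fn_le by (metis abs_of_nonneg)
      qed (use p in \<open>auto simp: N_def\<close>)
      finally show ?thesis .
    qed
    moreover have "\<exists>q\<in>grid Q. b q \<noteq> 0"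
    proof -
      have "(\<chi> i. R) \<in> (subgrid R Q :: (nat ^ 'd) set)"
        using R(1) RQ by (auto simp: subgrid_def grid_def)
      then show ?thesis by (intro bexI[of _ "\<chi> i. R"]) (auto simp: b_def subgrid_def)
    qed
    ultimately show ?thesis using \<psi>(1,2) by blast
  qed
  ultimately show ?thesis by (intro exI[of _ "1::nat"] exI[of _ c0]) blast
qed

end
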